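(* Let $g$ be a non-constant function in $H^{\infty}$. Then the integral operator $S_g:\mathcal{D}\to\mathcal{D}$ does not attain its norm on the Dirichlet space $\mathcal{D}$, i.e. there is no $f\in\mathcal{D}$ with $\|f\|_{\mathcal{D}}=1$ and $\|S_gf\|_{\mathcal{D}}=\|S_g\|$.
   Context: $\mathbb{D}$ is the open unit disc in $\mathbb{C}$, $H(\mathbb{D})$ is the space of analytic functions on $\mathbb{D}$, and $H^\infty$ is the set of bounded functions in $H(\mathbb{D})$. For $g\in H(\mathbb{D})$, the operator $S_g$ is defined on $H(\mathbb{D})$ by $S_gf(z)=\int_0^z f'(w)g(w)\,dw$. Let $dA(z)=\frac1\pi\,dx\,dy$. The Dirichlet space $\mathcal{D}$ is the space of all $f\in H(\mathbb{D})$ with $\int_{\mathbb{D}}|f'(z)|^2\,dA(z)<\infty$, with norm $\|f\|_{\mathcal{D}}=\big(|f(0)|^2+\int_{\mathbb{D}}|f'(z)|^2\,dA(z)\big)^{1/2}$. It is known that $S_g$ is bounded on $\mathcal{D}$ if and only if $g\in H^\infty$. $\|S_g\|$ denotes the operator norm of $S_g$ on $\mathcal{D}$. *)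

theory Defs
  imports "HOL-Complex_Analysis.Complex_Analysis"
begin

text \<open>
  A function on the unit disc is represented by a total function on \<^typ>\<open>complex\<close>; its values
  outside \<^term>\<open>ball 0 1 :: complex set\<close> are irrelevant.
\<close>

definition H_infinity :: "(complex \<Rightarrow> complex) set" where
  "H_infinity = {g. g holomorphic_on ball 0 1 \<and> bounded (g ` ball 0 1)}"

definition dA :: "complex measure" where
  "dA = density lborel (\<lambda>_. ennreal (1 / pi))"

definition dirichlet_space :: "(complex \<Rightarrow> complex) set" where
  "dirichlet_space =
     {f. f holomorphic_on ball 0 1 \<and> set_integrable dA (ball 0 1) (\<lambda>z. (cmod (deriv f z))\<^sup>2)}"

text \<open>Only meaningful for elements of \<^const>\<open>dirichlet_space\<close>.\<close>

definition dirichlet_norm :: "(complex \<Rightarrow> complex) \<Rightarrow> real" where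
  "dirichlet_norm f =
     sqrt ((cmod (f 0))\<^sup>2 + (LINT z:ball 0 1|dA. (cmod (deriv f z))\<^sup>2))"

text \<open>By Cauchy's theorem the path of integration in the disc is immaterial; we take the segment.\<close>

definition S_op :: "(complex \<Rightarrow> complex) \<Rightarrow> (complex \<Rightarrow> complex) \<Rightarrow> complex \<Rightarrow> complex" where
  "S_op g f z = contour_integral (linepath 0 z) (\<lambda>w. deriv f w * g w)"

text \<open>
  The operator norm on the Dirichlet space. As a real supremum it is only meaningful for bounded
  operators, such as \<^term>\<open>S_op g\<close> with \<^term>\<open>g \<in> H_infinity\<close>.
\<close>

definition dirichlet_onorm :: "((complex \<Rightarrow> complex) \<Rightarrow> complex \<Rightarrow> complex) \<Rightarrow> real" where
  "dirichlet_onorm T =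
     (SUP f\<in>{f \<in> dirichlet_space. dirichlet_norm f \<le> 1}. dirichlet_norm (T f))"

end

theory Submission
  imports Defs
begin

text \<open>
  On the disc the derivative of \<open>S_op g f\<close> is \<open>f' g\<close>, so \<open>S_op g\<close> acts on derivatives as
  multiplication by \<open>g\<close> in the square-integrable functions. Let \<open>N\<close> be its operator norm.

  The function \<open>g\<close> is bounded by \<open>N\<close> on the disc. Indeed, applying \<open>S_op g\<close> repeatedly to the
  identity function gives functions with derivative \<open>g ^ n\<close>, whose Dirichlet norms are at most
  a constant times \<open>N ^ n\<close>; but if \<open>\<bar>g\<bar> \<ge> K > N\<close> on some nonempty open subset of the disc, then
  these norms are at least a positive constant times \<open>K ^ n\<close>, which is impossible for large \<open>n\<close>
  (lemma \<open>cmod_le_dirichlet_onorm\<close>).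

  As \<open>g\<close> is not constant, the maximum modulus principle improves this to \<open>\<bar>g\<bar> < N\<close> throughout
  the disc. If \<open>f\<close> of norm 1 satisfied \<open>\<parallel>S_op g f\<parallel> = N\<close>, then the integral of the nonnegative
  function \<open>\<bar>f'\<bar>\<^sup>2 (N\<^sup>2 - \<bar>g\<bar>\<^sup>2)\<close> would be at most 0; hence \<open>f' = 0\<close> almost everywhere and
  \<open>N = \<parallel>S_op g f\<parallel> = 0\<close>, contradicting \<open>\<bar>g\<bar> < N\<close>.
\<close>

section \<open>Normalised area measure on the disc\<close>

lemma sets_dA [simp, measurable_cong]: "sets dA = sets borel"
  by (simp add: dA_def)

lemma space_dA [simp]: "space dA = UNIV"
  by (simp add: dA_def)

lemma emeasure_dA: "B \<in> sets borel \<Longrightarrow> emeasure dA B = ennreal (1 / pi) * emeasure lborel B"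
  by (simp add: dA_def emeasure_density_const)

lemma emeasure_dA_disc_finite: "emeasure dA (ball 0 1) < \<infinity>"
  using emeasure_bounded_finite[of "ball (0::complex) 1"]
  by (simp add: emeasure_dA ennreal_mult_less_top)

lemma set_borel_measurable_disc:
  fixes h :: "complex \<Rightarrow> real"
  assumes "continuous_on (ball 0 1) h"
  shows "set_borel_measurable dA (ball 0 1) h"
proof -
  have "(\<lambda>z. indicator (ball 0 1) z *\<^sub>R h z) \<in> borel_measurable borel"
    by (rule borel_measurable_continuous_on_indicator) (use assms in auto)
  then show ?thesis
    by (simp add: set_borel_measurable_def measurable_cong_sets[OF sets_dA refl])
qed

lemma set_integrable_disc_bounded:
  fixes h :: "complex \<Rightarrow> real"
  assumes "continuous_on (ball 0 1) h" "\<And>z. z \<in> ball 0 1 \<Longrightarrow> \<bar>h z\<bar> \<le> c"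
  shows "set_integrable dA (ball 0 1) h"
  unfolding set_integrable_def
proof (rule Bochner_Integration.integrable_bound)
  show "integrable dA (\<lambda>z. indicator (ball 0 1) z *\<^sub>R c)"
    using emeasure_dA_disc_finite by (intro integrable_scaleR_left) auto
  show "(\<lambda>z. indicator (ball 0 1) z *\<^sub>R h z) \<in> borel_measurable dA"
    using set_borel_measurable_disc[OF assms(1)] by (simp add: set_borel_measurable_def)
  show "AE z in dA. norm (indicator (ball 0 1) z *\<^sub>R h z) \<le> norm (indicator (ball 0 1) z *\<^sub>R c)"
    using assms(2) by (intro AE_I2) (force simp: indicator_def)
qed

section \<open>The Dirichlet norm\<close>

lemma dirichlet_norm_nonneg [simp]: "dirichlet_norm f \<ge> 0"
proof -
  have "(LINT z:ball 0 1|dA. (cmod (deriv f z))\<^sup>2) \<ge> 0"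
    by (simp add: set_lebesgue_integral_def)
  then show ?thesis by (simp add: dirichlet_norm_def)
qed

lemma dirichlet_norm_power2:
  "(dirichlet_norm f)\<^sup>2 = (cmod (f 0))\<^sup>2 + (LINT z:ball 0 1|dA. (cmod (deriv f z))\<^sup>2)"
proof -
  have "(LINT z:ball 0 1|dA. (cmod (deriv f z))\<^sup>2) \<ge> 0"
    by (simp add: set_lebesgue_integral_def)
  then show ?thesis by (simp add: dirichlet_norm_def)
qed

lemma continuous_on_cmod_deriv_power2:
  assumes "f holomorphic_on ball 0 1"
  shows "continuous_on (ball 0 1) (\<lambda>z. (cmod (deriv f z))\<^sup>2)"
  using holomorphic_on_imp_continuous_on[OF holomorphic_deriv[OF assms open_ball]]
  by (intro continuous_intros)

lemma id_in_dirichlet_space: "(\<lambda>z. z) \<in> dirichlet_space"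
  unfolding dirichlet_space_def
  by (auto intro!: set_integrable_disc_bounded[where c = 1] holomorphic_intros)

lemma
  assumes "f \<in> dirichlet_space"
  shows dirichlet_space_cmult: "(\<lambda>z. c * f z) \<in> dirichlet_space"
    and dirichlet_norm_cmult: "dirichlet_norm (\<lambda>z. c * f z) = cmod c * dirichlet_norm f"
proof -
  have hol: "f holomorphic_on ball 0 1"
    and int: "set_integrable dA (ball 0 1) (\<lambda>z. (cmod (deriv f z))\<^sup>2)"
    using assms by (auto simp: dirichlet_space_def)
  have d: "(cmod (deriv (\<lambda>z. c * f z) z))\<^sup>2 = (cmod c)\<^sup>2 * (cmod (deriv f z))\<^sup>2"
    if "z \<in> ball 0 1" for z
    using holomorphic_on_imp_differentiable_at[OF hol open_ball that]
    by (simp add: deriv_cmult norm_mult power_mult_distrib)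
  have "set_integrable dA (ball 0 1) (\<lambda>z. (cmod (deriv (\<lambda>z. c * f z) z))\<^sup>2) \<longleftrightarrow>
      set_integrable dA (ball 0 1) (\<lambda>z. (cmod c)\<^sup>2 * (cmod (deriv f z))\<^sup>2)"
    by (intro set_integrable_cong) (use d in auto)
  then show "(\<lambda>z. c * f z) \<in> dirichlet_space"
    using hol int by (auto simp: dirichlet_space_def intro!: holomorphic_intros)
  have "(LINT z:ball 0 1|dA. (cmod (deriv (\<lambda>z. c * f z) z))\<^sup>2) =
      (LINT z:ball 0 1|dA. (cmod c)\<^sup>2 * (cmod (deriv f z))\<^sup>2)"
    by (intro set_lebesgue_integral_cong) (use d in auto)
  then have "(dirichlet_norm (\<lambda>z. c * f z))\<^sup>2 = (cmod c * dirichlet_norm f)\<^sup>2"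
    by (simp add: dirichlet_norm_power2 power_mult_distrib norm_mult distrib_left)
  then show "dirichlet_norm (\<lambda>z. c * f z) = cmod c * dirichlet_norm f"
    by (simp add: power2_eq_iff_nonneg)
qed

section \<open>The integral operator as multiplication of derivatives\<close>

lemma S_op_has_field_derivative:
  assumes f: "f holomorphic_on ball 0 1" and g: "g holomorphic_on ball 0 1"
    and z: "z \<in> ball 0 1"
  shows "(S_op g f has_field_derivative deriv f z * g z) (at z)"
proof -
  have "(\<lambda>w. deriv f w * g w) holomorphic_on ball 0 1"
    using f g by (intro holomorphic_intros) auto
  then obtain F where F: "\<And>w. w \<in> ball 0 1 \<Longrightarrow>
      (F has_field_derivative deriv f w * g w) (at w within ball 0 1)"
    using holomorphic_convex_primitive'[of "ball 0 1" "\<lambda>w. deriv f w * g w"] by auto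
  have eq: "F w - F 0 = S_op g f w" if "w \<in> ball 0 1" for w
  proof -
    have "closed_segment 0 w \<subseteq> ball 0 1"
      using that by (intro closed_segment_subset) auto
    then have "((\<lambda>w. deriv f w * g w) has_contour_integral F w - F 0) (linepath 0 w)"
      using contour_integral_primitive[of "ball 0 1" F _ "linepath 0 w"] F by auto
    then show ?thesis
      by (simp add: S_op_def contour_integral_unique)
  qed
  have "((\<lambda>w. F w - F 0) has_field_derivative deriv f z * g z) (at z)"
    using F[OF z] z by (auto intro!: derivative_eq_intros simp: at_within_open[OF _ open_ball])
  then show ?thesis
    by (rule has_field_derivative_transform_within_open[OF _ open_ball z eq])
qed

lemma deriv_S_op:
  assumes "f holomorphic_on ball 0 1" "g holomorphic_on ball 0 1" "z \<in> ball 0 1"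
  shows "deriv (S_op g f) z = deriv f z * g z"
  using S_op_has_field_derivative[OF assms] by (rule DERIV_imp_deriv)

lemma S_op_holomorphic:
  assumes "f holomorphic_on ball 0 1" "g holomorphic_on ball 0 1"
  shows "S_op g f holomorphic_on ball 0 1"
  using S_op_has_field_derivative[OF assms] by (meson holomorphic_on_open open_ball)

lemma
  assumes f: "f \<in> dirichlet_space" and g: "g holomorphic_on ball 0 1"
    and M: "\<And>z. z \<in> ball 0 1 \<Longrightarrow> cmod (g z) \<le> M"
  shows S_op_in_dirichlet_space: "S_op g f \<in> dirichlet_space"
    and dirichlet_norm_S_op_power2:
      "(dirichlet_norm (S_op g f))\<^sup>2 =
        (LINT z:ball 0 1|dA. (cmod (deriv f z))\<^sup>2 * (cmod (g z))\<^sup>2)"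
    and set_integrable_deriv_mult:
      "set_integrable dA (ball 0 1) (\<lambda>z. (cmod (deriv f z))\<^sup>2 * (cmod (g z))\<^sup>2)"
    and dirichlet_norm_S_op_le: "dirichlet_norm (S_op g f) \<le> M * dirichlet_norm f"
proof -
  let ?h = "\<lambda>z. (cmod (deriv f z))\<^sup>2 * (cmod (g z))\<^sup>2"
  have hol: "f holomorphic_on ball 0 1"
    and int: "set_integrable dA (ball 0 1) (\<lambda>z. (cmod (deriv f z))\<^sup>2)"
    using f by (auto simp: dirichlet_space_def)
  have M0: "M \<ge> 0"
    using order_trans[OF norm_ge_zero M[of 0]] by simp
  have le: "?h z \<le> M\<^sup>2 * (cmod (deriv f z))\<^sup>2" if "z \<in> ball 0 1" for z
    using mult_left_mono[OF power_mono[OF M[OF that] norm_ge_zero, of 2], of "(cmod (deriv f z))\<^sup>2"]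
    by (simp add: mult.commute)
  have int': "set_integrable dA (ball 0 1) (\<lambda>z. M\<^sup>2 * (cmod (deriv f z))\<^sup>2)"
    using int by auto
  have "continuous_on (ball 0 1) ?h"
    using continuous_on_cmod_deriv_power2[OF hol] holomorphic_on_imp_continuous_on[OF g]
    by (intro continuous_on_mult continuous_on_power[OF continuous_on_norm[of _ g]])
  then have "set_borel_measurable dA (ball 0 1) ?h"
    by (rule set_borel_measurable_disc)
  then show int_h: "set_integrable dA (ball 0 1) ?h"
    by (intro set_integrable_bound[OF int']) (use le in \<open>auto intro!: AE_I2\<close>)
  have d: "(cmod (deriv (S_op g f) z))\<^sup>2 = ?h z" if "z \<in> ball 0 1" for z
    using deriv_S_op[OF hol g that] by (simp add: norm_mult power_mult_distrib)
  have "set_integrable dA (ball 0 1) (\<lambda>z. (cmod (deriv (S_op g f) z))\<^sup>2) \<longleftrightarrow>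
      set_integrable dA (ball 0 1) ?h"
    by (intro set_integrable_cong) (use d in auto)
  then show "S_op g f \<in> dirichlet_space"
    using S_op_holomorphic[OF hol g] int_h by (simp add: dirichlet_space_def)
  have "(LINT z:ball 0 1|dA. (cmod (deriv (S_op g f) z))\<^sup>2) = (LINT z:ball 0 1|dA. ?h z)"
    by (intro set_lebesgue_integral_cong) (use d in auto)
  moreover have "S_op g f 0 = 0"
    by (simp add: S_op_def)
  ultimately show eq: "(dirichlet_norm (S_op g f))\<^sup>2 = (LINT z:ball 0 1|dA. ?h z)"
    by (simp add: dirichlet_norm_power2)
  have "(LINT z:ball 0 1|dA. ?h z) \<le> (LINT z:ball 0 1|dA. M\<^sup>2 * (cmod (deriv f z))\<^sup>2)"
    by (intro set_integral_mono int_h int' le)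
  also have "\<dots> \<le> (M * dirichlet_norm f)\<^sup>2"
    by (simp add: dirichlet_norm_power2 power_mult_distrib distrib_left)
  finally show "dirichlet_norm (S_op g f) \<le> M * dirichlet_norm f"
    using M0 by (simp add: eq[symmetric] power2_le_iff_abs_le)
qed

section \<open>The operator norm bounds the symbol\<close>

text \<open>
  The operator norm is a supremum of reals, so it is an upper bound only because boundedness
  of \<open>g\<close> makes the values \<open>\<parallel>S_op g f\<parallel>\<close> on the unit ball bounded above.
\<close>

lemma dirichlet_norm_S_op_le_onorm_unit:
  assumes g: "g \<in> H_infinity" and f: "f \<in> dirichlet_space" "dirichlet_norm f \<le> 1"
  shows "dirichlet_norm (S_op g f) \<le> dirichlet_onorm (S_op g)"
  unfolding dirichlet_onorm_def
proof (rule cSUP_upper)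
  from g obtain M where hol: "g holomorphic_on ball 0 1"
    and M: "\<And>z. z \<in> ball 0 1 \<Longrightarrow> cmod (g z) \<le> M"
    unfolding H_infinity_def bounded_iff by blast
  have M0: "M \<ge> 0"
    using order_trans[OF norm_ge_zero M[of 0]] by simp
  show "bdd_above ((\<lambda>f. dirichlet_norm (S_op g f)) ` {f \<in> dirichlet_space. dirichlet_norm f \<le> 1})"
  proof (rule bdd_aboveI2)
    fix u assume u: "u \<in> {f \<in> dirichlet_space. dirichlet_norm f \<le> 1}"
    then have "dirichlet_norm (S_op g u) \<le> M * dirichlet_norm u"
      using dirichlet_norm_S_op_le[OF _ hol M] by blast
    also have "\<dots> \<le> M * 1"
      using u M0 by (intro mult_left_mono) auto
    finally show "dirichlet_norm (S_op g u) \<le> M" by simp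
  qed
qed (use f in auto)

lemma dirichlet_onorm_S_op_nonneg:
  assumes "g \<in> H_infinity"
  shows "dirichlet_onorm (S_op g) \<ge> 0"
proof -
  let ?zero = "\<lambda>z::complex. 0::complex"
  have "?zero \<in> dirichlet_space" "dirichlet_norm ?zero \<le> 1"
    by (auto simp: dirichlet_space_def dirichlet_norm_def set_integrable_def)
  then show ?thesis
    using dirichlet_norm_S_op_le_onorm_unit[OF assms] dirichlet_norm_nonneg order_trans by blast
qed

lemma dirichlet_norm_S_op_le_onorm:
  assumes g: "g \<in> H_infinity" and f: "f \<in> dirichlet_space"
  shows "dirichlet_norm (S_op g f) \<le> dirichlet_onorm (S_op g) * dirichlet_norm f"
proof -
  from g obtain M where hol: "g holomorphic_on ball 0 1"
    and M: "\<And>z. z \<in> ball 0 1 \<Longrightarrow> cmod (g z) \<le> M"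
    unfolding H_infinity_def bounded_iff by blast
  show ?thesis
  proof (cases "dirichlet_norm f = 0")
    case True
    then show ?thesis
      using dirichlet_norm_S_op_le[OF f hol M] by simp
  next
    case False
    define c where "c = inverse (dirichlet_norm f)"
    have c: "c > 0"
      using False dirichlet_norm_nonneg[of f] unfolding c_def
      by (simp add: less_le del: dirichlet_norm_nonneg)
    \<comment> \<open>The normalised function; only the derivatives enter the norm of its image, so it is
      enough that these scale by \<open>c\<close>.\<close>
    let ?h = "\<lambda>z. of_real c * f z"
    have h: "?h \<in> dirichlet_space" "dirichlet_norm ?h = 1"
      using dirichlet_space_cmult[OF f] dirichlet_norm_cmult[OF f, of "of_real c"] c False
      by (simp_all del: of_real_inverse) (simp add: c_def)
    have fhol: "f holomorphic_on ball 0 1"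
      using f by (simp add: dirichlet_space_def)
    have "(dirichlet_norm (S_op g ?h))\<^sup>2 = (c * dirichlet_norm (S_op g f))\<^sup>2"
    proof -
      have "(LINT z:ball 0 1|dA. (cmod (deriv ?h z))\<^sup>2 * (cmod (g z))\<^sup>2) =
          (LINT z:ball 0 1|dA. c\<^sup>2 * ((cmod (deriv f z))\<^sup>2 * (cmod (g z))\<^sup>2))"
      proof (intro set_lebesgue_integral_cong allI impI)
        fix z :: complex assume z: "z \<in> ball 0 1"
        show "(cmod (deriv ?h z))\<^sup>2 * (cmod (g z))\<^sup>2 =
            c\<^sup>2 * ((cmod (deriv f z))\<^sup>2 * (cmod (g z))\<^sup>2)"
          using holomorphic_on_imp_differentiable_at[OF fhol open_ball z]
          by (simp add: deriv_cmult norm_mult power_mult_distrib)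
      qed simp
      then show ?thesis
        using dirichlet_norm_S_op_power2[OF h(1) hol M] dirichlet_norm_S_op_power2[OF f hol M]
        by (simp add: power_mult_distrib)
    qed
    then have eq: "dirichlet_norm (S_op g ?h) = c * dirichlet_norm (S_op g f)"
      using c by (simp add: power2_eq_iff_nonneg)
    have "dirichlet_norm (S_op g ?h) \<le> dirichlet_onorm (S_op g)"
      by (rule dirichlet_norm_S_op_le_onorm_unit[OF g]) (use h in auto)
    then show ?thesis
      using c False unfolding eq by (simp add: c_def field_simps)
  qed
qed

lemma S_op_iterate_id:
  assumes g: "g \<in> H_infinity"
  shows "(S_op g ^^ n) (\<lambda>z. z) \<in> dirichlet_space"
    and "z \<in> ball 0 1 \<Longrightarrow> deriv ((S_op g ^^ n) (\<lambda>z. z)) z = g z ^ n"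
    and "dirichlet_norm ((S_op g ^^ n) (\<lambda>z. z)) \<le>
      dirichlet_onorm (S_op g) ^ n * dirichlet_norm (\<lambda>z. z)"
proof -
  from g obtain M where hol: "g holomorphic_on ball 0 1"
    and M: "\<And>z. z \<in> ball 0 1 \<Longrightarrow> cmod (g z) \<le> M"
    unfolding H_infinity_def bounded_iff by blast
  show in_D: "(S_op g ^^ n) (\<lambda>z. z) \<in> dirichlet_space" for n
    by (induction n) (use id_in_dirichlet_space S_op_in_dirichlet_space[OF _ hol M] in auto)
  show "deriv ((S_op g ^^ n) (\<lambda>z. z)) z = g z ^ n" if "z \<in> ball 0 1"
  proof (induction n)
    case (Suc n)
    have "(S_op g ^^ n) (\<lambda>z. z) holomorphic_on ball 0 1"
      using in_D by (simp add: dirichlet_space_def)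
    then show ?case
      using deriv_S_op[OF _ hol that] Suc by simp
  qed simp
  show "dirichlet_norm ((S_op g ^^ n) (\<lambda>z. z)) \<le>
      dirichlet_onorm (S_op g) ^ n * dirichlet_norm (\<lambda>z. z)"
  proof (induction n)
    case (Suc n)
    have "dirichlet_norm ((S_op g ^^ Suc n) (\<lambda>z. z)) \<le>
        dirichlet_onorm (S_op g) * dirichlet_norm ((S_op g ^^ n) (\<lambda>z. z))"
      using dirichlet_norm_S_op_le_onorm[OF g in_D] by simp
    also have "\<dots> \<le> dirichlet_onorm (S_op g) *
        (dirichlet_onorm (S_op g) ^ n * dirichlet_norm (\<lambda>z. z))"
      by (intro mult_left_mono Suc dirichlet_onorm_S_op_nonneg g)
    finally show ?case by (simp add: mult.assoc)
  qed simp
qed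

text \<open>
  The Dirichlet norms of the iterates of \<open>S_op g\<close> on the identity, whose squares are the
  integrals of \<open>\<bar>g\<bar> ^ (2 * n)\<close> over the disc, grow at most like \<open>N ^ n\<close>, but faster than this if
  \<open>\<bar>g\<bar>\<close> exceeds \<open>N\<close> on a disc \<open>ball a r\<close> of positive area \<open>m\<close>.
\<close>

lemma cmod_le_dirichlet_onorm:
  assumes g: "g \<in> H_infinity" and a: "a \<in> ball 0 1"
  shows "cmod (g a) \<le> dirichlet_onorm (S_op g)"
proof (rule ccontr)
  define N where "N = dirichlet_onorm (S_op g)"
  define C where "C = dirichlet_norm (\<lambda>z. z)"
  assume "\<not> cmod (g a) \<le> dirichlet_onorm (S_op g)"
  then obtain K where K: "N < K" "K < cmod (g a)"
    using dense[of N "cmod (g a)"] by (auto simp: N_def)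
  have N0: "N \<ge> 0"
    using dirichlet_onorm_S_op_nonneg[OF g] by (simp add: N_def)
  have cont: "continuous_on (ball 0 1) g"
    using g by (auto simp: H_infinity_def intro: holomorphic_on_imp_continuous_on)
  have "open {z \<in> ball 0 1. K < cmod (g z)}"
    using continuous_open_preimage[OF continuous_on_norm[OF cont] open_ball, of "{K<..}"]
    by (simp add: vimage_def Int_def)
  moreover have "a \<in> {z \<in> ball 0 1. K < cmod (g z)}"
    using a K(2) by simp
  ultimately obtain r where r: "r > 0" and sub: "ball a r \<subseteq> {z \<in> ball 0 1. K < cmod (g z)}"
    by (rule openE)
  define m where "m = measure dA (ball a r)"
  have m_pos: "m > 0"
    using content_ball_pos[OF r, of a] by (simp add: m_def measure_def emeasure_dA enn2real_mult)
  have m_finite: "emeasure dA (ball a r) < \<infinity>"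
    using emeasure_bounded_finite[of "ball a r"] by (simp add: emeasure_dA ennreal_mult_less_top)
  \<comment> \<open>Compare the lower bound \<open>K ^ (2 * n) * m\<close> and the upper bound \<open>(N ^ n * C)\<^sup>2\<close> for the
    squared norm of the \<open>n\<close>-th iterate.\<close>
  have "m \<le> ((N / K)\<^sup>2) ^ n * C\<^sup>2" for n
  proof -
    let ?u = "(S_op g ^^ n) (\<lambda>z. z)"
    have "(K ^ n)\<^sup>2 * m = (LINT z|dA. indicator (ball a r) z *\<^sub>R (K ^ n)\<^sup>2)"
      using m_finite by (simp add: m_def)
    also have "\<dots> \<le> (LINT z:ball 0 1|dA. (cmod (deriv ?u z))\<^sup>2)"
      unfolding set_lebesgue_integral_def
    proof (rule integral_mono)
      show "integrable dA (\<lambda>z. indicator (ball a r) z *\<^sub>R (K ^ n)\<^sup>2)"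
        using m_finite by (intro integrable_scaleR_left) auto
      show "integrable dA (\<lambda>z. indicator (ball 0 1) z *\<^sub>R (cmod (deriv ?u z))\<^sup>2)"
        using S_op_iterate_id(1)[OF g, of n] by (simp add: dirichlet_space_def set_integrable_def)
      fix z :: complex
      show "indicator (ball a r) z *\<^sub>R (K ^ n)\<^sup>2 \<le>
          indicator (ball 0 1) z *\<^sub>R (cmod (deriv ?u z))\<^sup>2"
      proof (cases "z \<in> ball a r")
        case True
        then have z: "z \<in> ball 0 1" "K < cmod (g z)"
          using sub by auto
        have "(K ^ n)\<^sup>2 \<le> (cmod (g z ^ n))\<^sup>2"
          using z(2) K(1) N0 by (auto simp: norm_power intro!: power_mono)
        then show ?thesis
          using True z(1) S_op_iterate_id(2)[OF g z(1)] by simp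
      qed simp
    qed
    also have "\<dots> \<le> (dirichlet_norm ?u)\<^sup>2"
      by (simp add: dirichlet_norm_power2)
    also have "\<dots> \<le> (N ^ n * C)\<^sup>2"
      unfolding N_def C_def by (intro power_mono S_op_iterate_id(3) g) simp
    finally show ?thesis
      using K(1) N0 by (simp add: field_simps power_mult_distrib power_divide flip: power_mult)
  qed
  moreover have "(\<lambda>n. ((N / K)\<^sup>2) ^ n * C\<^sup>2) \<longlonglongrightarrow> 0 * C\<^sup>2"
    using K(1) N0
    by (intro tendsto_mult tendsto_const LIMSEQ_power_zero) (simp add: abs_square_less_1)
  ultimately have "m \<le> 0"
    using LIMSEQ_le_const[of _ "0 * C\<^sup>2" m] by auto
  with m_pos show False by simp
qed

lemma cmod_less_dirichlet_onorm:
  assumes g: "g \<in> H_infinity" and nc: "\<not> g constant_on ball 0 1" and a: "a \<in> ball 0 1"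
  shows "cmod (g a) < dirichlet_onorm (S_op g)"
proof (rule ccontr)
  assume "\<not> cmod (g a) < dirichlet_onorm (S_op g)"
  then have "cmod (g z) \<le> cmod (g a)" if "z \<in> ball 0 1" for z
    using cmod_le_dirichlet_onorm[OF g that] by simp
  then have "g constant_on ball 0 1"
    using g a by (intro maximum_modulus_principle[of g "ball 0 1" "ball 0 1" a])
      (auto simp: H_infinity_def)
  with nc show False by simp
qed

section \<open>The norm is not attained\<close>

theorem theorem3:
  fixes g :: "complex \<Rightarrow> complex"
  assumes "g \<in> H_infinity"
    and "\<not> g constant_on ball 0 1"
  shows "\<not> (\<exists>f\<in>dirichlet_space.
            dirichlet_norm f = 1 \<and> dirichlet_norm (S_op g f) = dirichlet_onorm (S_op g))"
proof
  define N where "N = dirichlet_onorm (S_op g)"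
  assume "\<exists>f\<in>dirichlet_space.
      dirichlet_norm f = 1 \<and> dirichlet_norm (S_op g f) = dirichlet_onorm (S_op g)"
  then obtain f where f: "f \<in> dirichlet_space" and norm_f: "dirichlet_norm f = 1"
    and norm_S: "dirichlet_norm (S_op g f) = N"
    by (auto simp: N_def)
  have hol: "g holomorphic_on ball 0 1"
    using assms(1) by (simp add: H_infinity_def)
  have less: "cmod (g z) < N" if "z \<in> ball 0 1" for z
    using cmod_less_dirichlet_onorm[OF assms that] by (simp add: N_def)
  have le: "cmod (g z) \<le> N" if "z \<in> ball 0 1" for z
    using less[OF that] by simp
  let ?d = "\<lambda>z. (cmod (deriv f z))\<^sup>2" and ?h = "\<lambda>z. (cmod (deriv f z))\<^sup>2 * (cmod (g z))\<^sup>2"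
  let ?k = "\<lambda>z. indicator (ball 0 1) z *\<^sub>R (N\<^sup>2 * ?d z - ?h z)"
  have int_d: "set_integrable dA (ball 0 1) (\<lambda>z. N\<^sup>2 * ?d z)"
    using f by (auto simp: dirichlet_space_def)
  have int_h: "set_integrable dA (ball 0 1) ?h"
    by (rule set_integrable_deriv_mult[OF f hol le])
  have int_k: "integrable dA ?k"
    using set_integral_diff(1)[OF int_d int_h] by (simp add: set_integrable_def)
  have k_nonneg: "?k z \<ge> 0" for z
  proof (cases "z \<in> ball 0 1")
    case True
    have "(cmod (g z))\<^sup>2 \<le> N\<^sup>2"
      using le[OF True] by (intro power_mono) auto
    then show ?thesis
      using mult_left_mono[of "(cmod (g z))\<^sup>2" "N\<^sup>2" "?d z"] by (simp add: mult.commute)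
  qed simp
  \<comment> \<open>The last term is the squared norm of the image; the first is at most \<open>N\<^sup>2\<close> because \<open>f\<close> has
    norm 1.\<close>
  have "(LINT z|dA. ?k z) = N\<^sup>2 * (LINT z:ball 0 1|dA. ?d z) - N\<^sup>2"
    using set_integral_diff(2)[OF int_d int_h] dirichlet_norm_S_op_power2[OF f hol le] norm_S
    by (simp add: set_lebesgue_integral_def)
  also have "\<dots> \<le> 0"
  proof -
    have "(LINT z:ball 0 1|dA. ?d z) \<le> 1"
      using dirichlet_norm_power2[of f] zero_le_power2[of "cmod (f 0)"]
      unfolding norm_f one_power2 by linarith
    then show ?thesis
      using mult_left_mono[of _ 1 "N\<^sup>2"] by simp
  qed
  finally have "(LINT z|dA. ?k z) = 0"
    using Bochner_Integration.integral_nonneg[of dA ?k, OF k_nonneg] by (rule antisym)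
  then have "AE z in dA. ?k z = 0"
    using integral_nonneg_eq_0_iff_AE[OF int_k] k_nonneg by simp
  then have "AE z in dA. indicator (ball 0 1) z *\<^sub>R ?h z = 0"
  proof eventually_elim
    case (elim z)
    show ?case
    proof (cases "z \<in> ball 0 1")
      case True
      have "(cmod (g z))\<^sup>2 < N\<^sup>2"
        using less[OF True] by (intro power_strict_mono) auto
      moreover have "?d z * (N\<^sup>2 - (cmod (g z))\<^sup>2) = 0"
        using elim True by (simp add: algebra_simps)
      ultimately show ?thesis by simp
    qed simp
  qed
  then have "(LINT z:ball 0 1|dA. ?h z) = 0"
    unfolding set_lebesgue_integral_def by (rule integral_eq_zero_AE)
  then have "N = 0"
    using dirichlet_norm_S_op_power2[OF f hol le] norm_S by simp
  then show False
    using less[of 0] by simp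
qed

end
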